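(* Let $r_+(n)$ be the ordinary first-moment root and $r_4^{\mathrm{co}}(n)$ the signed four-size first-moment root (both defined in the context, for all sufficiently large $n$). Then there is a deterministic sequence $o(1)\to0$ such that for all sufficiently large $n$ $$r_+(n)-r_4^{\mathrm{co}}(n)=\Big[\frac{(\log 2)^2}{4}A_4(\delta_n)+o(1)\Big]\frac{n}{(\log n)^3}.$$
   Context: Logarithms are natural unless a base is shown. Put $\alpha_0(n):=2\log_2 n-2\log_2\log_2 n+2\log_2(\mathrm e/2)+1$, $\alpha:=\lfloor\alpha_0(n)\rfloor$, $\delta_n:=\alpha_0(n)-\alpha$, $s_0:=\alpha_0(n)-1-\frac{2}{\log 2}$, and $d_u:=2^{\binom u2}u!$ for integers $u\ge1$. Let $S_+:=\{-1,0,1,2,\dots\}$, $S_4:=\{2,3,4,5\}$, $S_+^{(n)}:=\{-1,0,\dots,\alpha-1\}$, $S_4^{(n)}:=S_4$. For $S\in\{S_+,S_4\}$ and real $k>0$, call $k$ feasible for $S$ if there are reals $k_i\ge0$ $(i\in S^{(n)})$ with $\sum_i k_i=k$ and $\sum_i(\alpha-i)k_i=n$; in that case let $L_S(n,k)$ be the maximum over all such $(k_i)$ of $$n\log n-n+k-\sum_{i\in S^{(n)}}k_i\log(k_i d_{\alpha-i}),\qquad 0\log 0:=0.$$ There is an absolute constant $A_*>0$ such that, for all sufficiently large $n$, for each $S\in\{S_+,S_4\}$ and each $0\le c\le\log 2$ the equation $L_S(n,k)+ck=0$ has exactly one feasible solution $k=r_{S,c}$ with $|n/k-s_0|\le A_*\log\log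 n/\log n$. Fix such an $A_*$ and put $r_+(n):=r_{S_+,0}$ and $r_4^{\mathrm{co}}(n):=r_{S_4,\log 2}$. For $S\in\{S_+,S_4\}$ and $T\in(2,5)$ put $\mathcal F_S(T):=\inf_{\lambda\in\mathbb R}\{\log\sum_{i\in S}\exp(\lambda i-\frac{\log 2}{2}i^2)-\lambda T\}$, and for $0\le\delta\le1$ put $T_\delta:=1+\frac2{\log 2}-\delta\in(2,5)$ and $A_4(\delta):=\log 2-\mathcal F_{S_+}(T_\delta)+\mathcal F_{S_4}(T_\delta)$. *)

theory Defs
  imports "HOL-Analysis.Analysis"
begin

definition alpha0 :: "nat \<Rightarrow> real" where
  "alpha0 n = 2 * log 2 (real n) - 2 * log 2 (log 2 (real n)) + 2 * log 2 (exp 1 / 2) + 1"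

definition alpha :: "nat \<Rightarrow> int" where
  "alpha n = \<lfloor>alpha0 n\<rfloor>"

definition delta :: "nat \<Rightarrow> real" where
  "delta n = alpha0 n - of_int (alpha n)"

definition s0 :: "nat \<Rightarrow> real" where
  "s0 n = alpha0 n - 1 - 2 / ln 2"

definition d_size :: "nat \<Rightarrow> real" where
  "d_size u = 2 ^ (u choose 2) * fact u"

definition S_plus :: "int set" where
  "S_plus = {-1..}"

definition S_four :: "int set" where
  "S_four = {2, 3, 4, 5}"

definition S_plus_upto :: "nat \<Rightarrow> int set" where
  "S_plus_upto n = {-1..alpha n - 1}"

definition S_four_upto :: "nat \<Rightarrow> int set" where
  "S_four_upto n = S_four"

text \<open>In the following, \<open>I\<close> is the (finite) set of offsets \<open>i\<close>, i.e. of sizes \<open>\<alpha> - i\<close>,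
  belonging to \<open>n\<close>. Only the values of \<open>\<kappa>\<close> on \<open>I\<close> matter.\<close>

definition allocations :: "int set \<Rightarrow> nat \<Rightarrow> real \<Rightarrow> (int \<Rightarrow> real) set" where
  "allocations I n k =
    {\<kappa>. (\<forall>i\<in>I. 0 \<le> \<kappa> i) \<and> (\<Sum>i\<in>I. \<kappa> i) = k \<and>
         (\<Sum>i\<in>I. of_int (alpha n - i) * \<kappa> i) = real n}"

definition feasible :: "int set \<Rightarrow> nat \<Rightarrow> real \<Rightarrow> bool" where
  "feasible I n k \<longleftrightarrow> 0 < k \<and> allocations I n k \<noteq> {}"

text \<open>The convention \<open>0 log 0 = 0\<close> is automatic.\<close>

definition objective :: "int set \<Rightarrow> nat \<Rightarrow> real \<Rightarrow> (int \<Rightarrow> real) \<Rightarrow> real" where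
  "objective I n k \<kappa> =
    real n * ln (real n) - real n + k - (\<Sum>i\<in>I. \<kappa> i * ln (\<kappa> i * d_size (nat (alpha n - i))))"

text \<open>For feasible \<open>k\<close> and finite \<open>I\<close> the supremum is a maximum; see \<open>L_is_maximum\<close> below.\<close>

definition L_max :: "int set \<Rightarrow> nat \<Rightarrow> real \<Rightarrow> real" where
  "L_max I n k = (SUP \<kappa>\<in>allocations I n k. objective I n k \<kappa>)"

definition is_root :: "real \<Rightarrow> int set \<Rightarrow> real \<Rightarrow> nat \<Rightarrow> real \<Rightarrow> bool" where
  "is_root A I c n k \<longleftrightarrow>
    feasible I n k \<and> L_max I n k + c * k = 0 \<and>
    \<bar>real n / k - s0 n\<bar> \<le> A * ln (ln (real n)) / ln (real n)"

definition admissible_window :: "real \<Rightarrow> bool" where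
  "admissible_window A \<longleftrightarrow>
    0 < A \<and>
    (\<forall>\<^sub>F n in sequentially. \<forall>I\<in>{S_plus_upto n, S_four_upto n}. \<forall>c\<in>{0..ln 2}.
       \<exists>!k. is_root A I c n k)"

definition fm_root :: "real \<Rightarrow> int set \<Rightarrow> real \<Rightarrow> nat \<Rightarrow> real" where
  "fm_root A I c n = (THE k. is_root A I c n k)"

definition r_plus :: "real \<Rightarrow> nat \<Rightarrow> real" where
  "r_plus A n = fm_root A (S_plus_upto n) 0 n"

definition r_four_co :: "real \<Rightarrow> nat \<Rightarrow> real" where
  "r_four_co A n = fm_root A (S_four_upto n) (ln 2) n"

definition calF :: "int set \<Rightarrow> real \<Rightarrow> real" where
  "calF S T =
    (INF l::real. ln (\<Sum>\<^sub>\<infinity>i\<in>S. exp (l * of_int i - ln 2 / 2 * (of_int i)\<^sup>2)) - l * T)"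

definition T_of :: "real \<Rightarrow> real" where
  "T_of \<delta> = 1 + 2 / ln 2 - \<delta>"

definition A4 :: "real \<Rightarrow> real" where
  "A4 \<delta> = ln 2 - calF S_plus (T_of \<delta>) + calF S_four (T_of \<delta>)"

lemma continuous_on_mult_ln:
  assumes "(c::real) > 0"
  shows "continuous_on {0..} (\<lambda>x::real. x * ln (x * c))"
proof -
  have "((\<lambda>x::real. ln (inverse x) / inverse x) \<longlongrightarrow> 0) (at_right 0)"
    by (rule filterlim_compose[OF ln_x_over_x_tendsto_0 filterlim_inverse_at_top_right])
  hence "((\<lambda>x. x * ln c - ln (inverse x) / inverse x) \<longlongrightarrow> 0 * ln c - 0) (at_right 0)"
    by (intro tendsto_intros)
  hence "((\<lambda>x. x * ln c - ln (inverse x) / inverse x) \<longlongrightarrow> 0) (at_right 0)"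
    by simp
  moreover have "\<forall>\<^sub>F x in at_right 0.
      x * ln c - ln (inverse x) / inverse x = x * ln (x * c)"
    using eventually_at_right_less
    by eventually_elim
       (use assms in \<open>simp add: ln_mult ln_inverse divide_inverse algebra_simps\<close>)
  ultimately have "((\<lambda>x::real. x * ln (x * c)) \<longlongrightarrow> 0) (at_right 0)"
    by (rule Lim_transform_eventually)
  moreover have "isCont (\<lambda>x::real. x * ln (x * c)) x" if "x > 0" for x
    using that assms by (intro continuous_intros) auto
  ultimately show ?thesis
    unfolding continuous_on_eq_continuous_within
  proof (intro ballI)
    fix x :: real
    assume lim: "((\<lambda>x. x * ln (x * c)) \<longlongrightarrow> 0) (at_right 0)"
      and cont: "\<And>x. x > 0 \<Longrightarrow> isCont (\<lambda>x. x * ln (x * c)) x" and x: "x \<in> {0..}"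
    show "continuous (at x within {0..}) (\<lambda>x. x * ln (x * c))"
    proof (cases "x = 0")
      case True
      show ?thesis
        unfolding continuous_within True at_within_Ici_at_right mult_zero_left by (rule lim)
    next
      case False
      with x have "x > 0" by simp
      thus ?thesis
        by (rule continuous_at_imp_continuous_within[OF cont])
    qed
  qed
qed

lemma L_is_maximum:
  assumes "finite I" and "feasible I n k"
  shows "\<exists>\<kappa>\<in>allocations I n k. objective I n k \<kappa> = L_max I n k \<and>
           (\<forall>\<kappa>'\<in>allocations I n k. objective I n k \<kappa>' \<le> objective I n k \<kappa>)"
proof -
  define B where "B = PiE UNIV (\<lambda>i. if i \<in> I then {0..k} else {0::real})"
  define K where "K = B \<inter> {\<kappa>. (\<Sum>i\<in>I. \<kappa> i) = k} \<inter>
                     {\<kappa>. (\<Sum>i\<in>I. of_int (alpha n - i) * \<kappa> i) = real n}"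
  have "compactin (product_topology (\<lambda>i::int. euclidean) UNIV) B"
    unfolding B_def compactin_PiE by auto
  hence "compact B"
    by (simp add: euclidean_product_topology)
  have coord: "continuous_on X (\<lambda>\<kappa>::int \<Rightarrow> real. \<kappa> i)" for X i
    by (rule continuous_on_subset[OF continuous_on_product_coordinates]) simp
  have "compact K"
    unfolding K_def
    by (intro compact_Int_closed \<open>compact B\<close> closed_Collect_eq continuous_on_sum
          continuous_on_mult continuous_on_const coord)
  have KB: "0 \<le> \<kappa> i \<and> \<kappa> i \<le> k" if "\<kappa> \<in> K" "i \<in> I" for \<kappa> i
    using that by (auto simp: K_def B_def PiE_iff split: if_splits dest!: spec[of _ i])
  have dpos: "d_size u > 0" for u
    by (simp add: d_size_def)
  have "continuous_on K (\<lambda>\<kappa>. \<kappa> i * ln (\<kappa> i * d_size (nat (alpha n - i))))" if "i \<in> I" for i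
    by (rule continuous_on_compose2[OF continuous_on_mult_ln[OF dpos], of K "\<lambda>\<kappa>. \<kappa> i"])
       (use KB that coord in auto)
  hence cont: "continuous_on K (objective I n k)"
    unfolding objective_def
    by (intro continuous_on_diff continuous_on_sum continuous_on_const)
  have proj: "\<exists>\<kappa>'\<in>K. objective I n k \<kappa>' = objective I n k \<kappa>"
    if \<kappa>: "\<kappa> \<in> allocations I n k" for \<kappa>
  proof
    let ?\<kappa> = "\<lambda>i. if i \<in> I then \<kappa> i else 0"
    have "\<kappa> i \<le> k" if "i \<in> I" for i
      using \<kappa> that assms(1) member_le_sum[of i I \<kappa>] by (auto simp: allocations_def)
    thus "?\<kappa> \<in> K"
      using \<kappa> by (auto simp: K_def B_def allocations_def PiE_iff)
    show "objective I n k ?\<kappa> = objective I n k \<kappa>"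
      by (auto simp: objective_def)
  qed
  have sub: "K \<subseteq> allocations I n k"
    using KB by (auto simp: allocations_def K_def)
  have "K \<noteq> {}"
    using assms(2) proj by (auto simp: feasible_def)
  then obtain \<kappa> where \<kappa>: "\<kappa> \<in> K" "\<And>\<kappa>'. \<kappa>' \<in> K \<Longrightarrow> objective I n k \<kappa>' \<le> objective I n k \<kappa>"
    using continuous_attains_sup[OF \<open>compact K\<close> _ cont] by blast
  have max: "objective I n k \<kappa>' \<le> objective I n k \<kappa>" if "\<kappa>' \<in> allocations I n k" for \<kappa>'
    using proj[OF that] \<kappa>(2) by metis
  moreover have "L_max I n k = objective I n k \<kappa>"
    unfolding L_max_def by (rule cSup_eq_maximum) (use \<kappa>(1) sub max in auto)
  ultimately show ?thesis
    using \<kappa>(1) sub by (intro bexI[of _ \<kappa>]) auto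
qed

end

theory Submission
  imports Defs "HOL-Real_Asymp.Real_Asymp"
begin

text \<open>With \<open>p = \<kappa> / k\<close> and \<open>s = n / k\<close>, the value \<open>L_max I n k / k\<close> splits into
  \<open>base_exponent n s\<close>, which does not depend on the set of sizes, plus the maximum of entropy minus
  quadratic energy over the measures \<open>p\<close> on offsets with mean \<open>\<alpha> - s\<close>, up to the error in
  replacing \<open>ln (\<alpha> - i)!\<close> by \<open>ln \<alpha>! - i ln \<alpha>\<close>. By convex duality that maximum tends to \<open>calF\<close>.
  Subtracting the two root equations, the base exponents at the two roots differ by
  \<open>A4 \<delta> + o(1)\<close>; since the base exponent is \<open>s\<close> times \<open>- (1 + o(1)) ln n\<close> plus lower-order
  terms, and \<open>s\<close> is \<open>(2 / ln 2 + o(1)) ln n\<close>, this gap determines \<open>n / s\<^sub>1 - n / s\<^sub>2\<close>.\<close>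

section \<open>The limiting variational problem\<close>

definition partition_fun :: "int set \<Rightarrow> real \<Rightarrow> real" where
  "partition_fun S l = (\<Sum>\<^sub>\<infinity>i\<in>S. exp (l * of_int i - ln 2 / 2 * (of_int i)\<^sup>2))"

lemma calF_eq: "calF S T = (INF l. ln (partition_fun S l) - l * T)"
  by (simp add: calF_def partition_fun_def)

lemma gauss_summable:
  fixes l :: real
  assumes "S \<subseteq> S_plus"
  shows "(\<lambda>i. exp (l * of_int i - ln 2 / 2 * (of_int i)\<^sup>2)) summable_on S"
proof -
  define K where "K = exp ((l + 1)\<^sup>2 / (2 * ln 2))"
  have bound: "exp (l * x - ln 2 / 2 * x\<^sup>2) \<le> K * exp (- x)" for x :: real
  proof -
    define c :: real where "c = ln 2"
    have "c > 0" by (simp add: c_def)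
    have "2 * c * ((l + 1) * x - c / 2 * x\<^sup>2) = (l + 1)\<^sup>2 - (c * x - (l + 1))\<^sup>2"
      by (simp add: power2_eq_square algebra_simps)
    hence "2 * c * ((l + 1) * x - c / 2 * x\<^sup>2) \<le> (l + 1)\<^sup>2" by simp
    hence "(l + 1) * x - c / 2 * x\<^sup>2 \<le> (l + 1)\<^sup>2 / (2 * c)"
      using \<open>c > 0\<close> by (subst pos_le_divide_eq) (simp_all add: mult.commute)
    hence "l * x - ln 2 / 2 * x\<^sup>2 \<le> (l + 1)\<^sup>2 / (2 * ln 2) + - x"
      by (simp add: c_def distrib_right)
    thus ?thesis by (simp add: K_def flip: exp_add)
  qed
  have "summable (\<lambda>m. exp (-1 :: real) ^ m)"
    by (rule summable_geometric) simp
  hence "summable (\<lambda>m. K * exp 1 * exp (-1) ^ m)"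
    by (rule summable_mult)
  hence "(\<lambda>m. K * exp 1 * exp (-1) ^ m) summable_on (UNIV :: nat set)"
    by (subst summable_on_UNIV_nonneg_real_iff) (simp_all add: K_def)
  also have "(\<lambda>m::nat. K * exp 1 * exp (-1) ^ m) =
      (\<lambda>i. K * exp (- real_of_int i)) \<circ> (\<lambda>m. int m - 1)"
    by (simp add: fun_eq_iff flip: exp_of_nat_mult exp_add)
  finally have "(\<lambda>i. K * exp (- real_of_int i)) summable_on range (\<lambda>m. int m - 1)"
    by (subst summable_on_reindex) (simp_all add: inj_on_def o_def)
  moreover have "S \<subseteq> range (\<lambda>m. int m - 1)"
  proof
    fix i assume "i \<in> S"
    with assms have "i = int (nat (i + 1)) - 1" by (auto simp: S_plus_def)
    thus "i \<in> range (\<lambda>m. int m - 1)" by blast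
  qed
  ultimately have "(\<lambda>i. K * exp (- real_of_int i)) summable_on S"
    by (rule summable_on_subset_banach)
  thus ?thesis
    by (rule summable_on_comparison_test) (use bound in auto)
qed

lemma partition_fun_finite:
  "finite I \<Longrightarrow> partition_fun I l = (\<Sum>i\<in>I. exp (l * of_int i - ln 2 / 2 * (of_int i)\<^sup>2))"
  by (simp add: partition_fun_def)

lemma partition_fun_mono:
  assumes "I \<subseteq> S" "S \<subseteq> S_plus"
  shows "partition_fun I l \<le> partition_fun S l"
  unfolding partition_fun_def
  by (rule infsum_mono2[OF gauss_summable[OF subset_trans[OF assms]] gauss_summable[OF assms(2)]])
     (use assms in auto)

lemma partition_fun_ge_term:
  assumes "i \<in> S" "S \<subseteq> S_plus"
  shows "exp (l * of_int i - ln 2 / 2 * (of_int i)\<^sup>2) \<le> partition_fun S l"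
  using partition_fun_mono[of "{i}" S l] assms by (simp add: partition_fun_def)

lemma partition_fun_pos:
  assumes "S_four \<subseteq> S" "S \<subseteq> S_plus"
  shows "partition_fun S l > 0"
proof -
  have "2 \<in> S" using assms by (auto simp: S_four_def)
  from partition_fun_ge_term[OF this assms(2), of l] show ?thesis
    using exp_gt_zero by (rule less_le_trans[rotated])
qed

lemma dual_coercive:
  assumes "S_four \<subseteq> S" "S \<subseteq> S_plus" "T \<in> {5/2..9/2}"
  shows "\<bar>l\<bar> / 2 - 25 / 2 * ln 2 \<le> ln (partition_fun S l) - l * T"
proof -
  have ge: "l * of_int i - ln 2 / 2 * (of_int i)\<^sup>2 \<le> ln (partition_fun S l)" if "i \<in> S" for i
    using partition_fun_ge_term[OF that assms(2), of l] partition_fun_pos[OF assms(1,2), of l]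
    by (simp add: ln_ge_iff)
  have "2 \<in> S" "5 \<in> S" using assms by (auto simp: S_four_def)
  from ge[OF this(1)] ge[OF this(2)]
  have 2: "l * 2 - 2 * ln 2 \<le> ln (partition_fun S l)"
    and 5: "l * 5 - 25 / 2 * ln 2 \<le> ln (partition_fun S l)" by (simp_all add: field_simps)
  have pos: "ln 2 > (0::real)" by simp
  show ?thesis
  proof (cases "l \<ge> 0")
    case True
    hence "l * T \<le> l * (9/2)" using assms by (intro mult_left_mono) auto
    with 5 True show ?thesis by simp
  next
    case False
    hence "l * T \<le> l * (5/2)" using assms by (intro mult_left_mono_neg) auto
    with 2 False pos show ?thesis by linarith
  qed
qed

lemma dual_bdd_below:
  assumes "S_four \<subseteq> S" "S \<subseteq> S_plus" "T \<in> {5/2..9/2}"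
  shows "bdd_below (range (\<lambda>l. ln (partition_fun S l) - l * T))"
proof (rule bdd_belowI2)
  fix l show "- (25 / 2 * ln 2) \<le> ln (partition_fun S l) - l * T"
    using dual_coercive[OF assms, of l] by simp
qed

lemma calF_le:
  assumes "S_four \<subseteq> S" "S \<subseteq> S_plus" "T \<in> {5/2..9/2}"
  shows "calF S T \<le> ln (partition_fun S l) - l * T"
  unfolding calF_eq by (rule cINF_lower[OF dual_bdd_below[OF assms]]) simp

lemma ln_partition_fun_0_le:
  assumes "S_four \<subseteq> S" "S \<subseteq> S_plus"
  shows "ln (partition_fun S 0) \<le> ln (partition_fun S_plus 0)"
  by (rule ln_mono[OF partition_fun_mono[OF assms(2) order_refl] partition_fun_pos[OF assms]])

text \<open>A bound on all near-minimisers of the dual problem, uniform in the set of offsets.\<close>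

definition dual_radius :: real where
  "dual_radius = 2 * (25 / 2 * ln 2 + ln (partition_fun S_plus 0) + 1)"

lemma S_four_subset_S_plus: "S_four \<subseteq> S_plus"
  by (auto simp: S_four_def S_plus_def)

lemma dual_radius_ge: "dual_radius \<ge> 2"
  using dual_coercive[OF S_four_subset_S_plus order_refl, of 3 0]
  by (simp add: dual_radius_def)

lemma near_minimiser_bounded:
  assumes "S_four \<subseteq> S" "S \<subseteq> S_plus" "T \<in> {5/2..9/2}"
    and "ln (partition_fun S l) - l * T \<le> ln (partition_fun S 0) + 1"
  shows "\<bar>l\<bar> \<le> dual_radius"
  using dual_coercive[OF assms(1-3), of l] assms(4) ln_partition_fun_0_le[OF assms(1,2)]
  by (simp add: dual_radius_def)

lemma near_minimiser_exists:
  assumes "S_four \<subseteq> S" "S \<subseteq> S_plus" "T \<in> {5/2..9/2}" "0 < \<eta>" "\<eta> \<le> 1"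
  obtains l where "\<bar>l\<bar> \<le> dual_radius" "ln (partition_fun S l) - l * T < calF S T + \<eta>"
proof -
  have "\<exists>l\<in>UNIV. ln (partition_fun S l) - l * T < calF S T + \<eta>"
    using cINF_less_iff[OF _ dual_bdd_below[OF assms(1-3)], of "calF S T + \<eta>"] assms(4)
    by (simp add: calF_eq)
  then obtain l where l: "ln (partition_fun S l) - l * T < calF S T + \<eta>" by blast
  moreover have "\<bar>l\<bar> \<le> dual_radius"
    by (rule near_minimiser_bounded[OF assms(1-3)])
       (use l calF_le[OF assms(1-3), of 0] assms(5) in simp)
  ultimately show ?thesis using that by blast
qed

lemma calF_bounded:
  assumes "S_four \<subseteq> S" "S \<subseteq> S_plus" "T \<in> {5/2..9/2}"
  shows "\<bar>calF S T\<bar> \<le> dual_radius"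
proof -
  define q :: real where "q = 25 / 2 * ln 2"
  define r where "r = ln (partition_fun S_plus 0)"
  have "- q \<le> calF S T"
    unfolding calF_eq
  proof (rule cINF_greatest)
    fix l show "- q \<le> ln (partition_fun S l) - l * T"
      using dual_coercive[OF assms, of l] by (simp add: q_def)
  qed simp
  moreover have "calF S T \<le> r"
    using calF_le[OF assms, of 0] ln_partition_fun_0_le[OF assms(1,2)] by (simp add: r_def)
  moreover have "1 \<le> partition_fun S_plus 0"
    using partition_fun_ge_term[of 0 S_plus 0] by (simp add: S_plus_def)
  hence "r \<ge> 0" by (simp add: r_def)
  moreover have "q > 0" by (simp add: q_def)
  moreover have "dual_radius = 2 * q + 2 * r + 2"
    by (simp add: dual_radius_def q_def r_def)
  ultimately show ?thesis by linarith
qed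

lemma calF_lipschitz:
  assumes "S_four \<subseteq> S" "S \<subseteq> S_plus" "T \<in> {5/2..9/2}" "T' \<in> {5/2..9/2}"
  shows "\<bar>calF S T' - calF S T\<bar> \<le> dual_radius * \<bar>T' - T\<bar>"
proof -
  have one_sided: "calF S T' \<le> calF S T + dual_radius * \<bar>T' - T\<bar>"
    if T: "T \<in> {5/2..9/2}" "T' \<in> {5/2..9/2}" for T T'
  proof (rule field_le_epsilon)
    fix e :: real assume "e > 0"
    then obtain l where l: "\<bar>l\<bar> \<le> dual_radius"
        "ln (partition_fun S l) - l * T < calF S T + min e 1"
      using near_minimiser_exists[OF assms(1,2) T(1), of "min e 1"] by auto
    have "calF S T' \<le> ln (partition_fun S l) - l * T'"
      by (rule calF_le[OF assms(1,2) T(2)])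
    also have "\<dots> = (ln (partition_fun S l) - l * T) + l * (T - T')"
      by (simp add: algebra_simps)
    also have "l * (T - T') \<le> \<bar>l\<bar> * \<bar>T' - T\<bar>"
      by (metis abs_ge_self abs_minus_commute abs_mult)
    also have "\<dots> \<le> dual_radius * \<bar>T' - T\<bar>"
      using l(1) by (intro mult_right_mono) auto
    finally show "calF S T' \<le> calF S T + dual_radius * \<bar>T' - T\<bar> + e"
      using l(2) by linarith
  qed
  from one_sided[OF assms(3,4)] one_sided[OF assms(4,3)] show ?thesis
    by (simp add: abs_minus_commute abs_le_iff)
qed

lemma calF_truncation:
  assumes "0 < \<epsilon>"
  obtains M where "5 \<le> M" "\<And>T. T \<in> {5/2..9/2} \<Longrightarrow> calF S_plus T - \<epsilon> \<le> calF {-1..M} T"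
proof -
  define R where "R = dual_radius"
  define f where "f = (\<lambda>l i. exp (l * of_int i - ln 2 / 2 * (of_int i)\<^sup>2) :: real)"
  define h where "h = (\<lambda>i. f R i + f (-R) i)"
  define c where "c = exp (- (2 * R) - 2 * ln 2 :: real)"
  have "c > 0" by (simp add: c_def)
  have f_sum: "f l summable_on S" if "S \<subseteq> S_plus" for l S
    unfolding f_def by (rule gauss_summable[OF that])
  have h_sum: "h summable_on S" if "S \<subseteq> S_plus" for S
    unfolding h_def by (intro summable_on_add f_sum that)
  have h_nonneg: "h i \<ge> 0" for i by (simp add: h_def f_def)
  have fh: "f l i \<le> h i" if "\<bar>l\<bar> \<le> R" for l i
  proof (cases "i \<ge> 0")
    case True
    hence "l * of_int i \<le> R * of_int i" using that by (intro mult_right_mono) auto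
    hence "f l i \<le> f R i" by (simp add: f_def)
    thus ?thesis by (simp add: h_def f_def add_increasing2)
  next
    case False
    hence "l * of_int i \<le> - R * of_int i" using that by (intro mult_right_mono_neg) auto
    hence "f l i \<le> f (-R) i" by (simp add: f_def)
    thus ?thesis by (simp add: h_def f_def add_increasing)
  qed
  have "(h has_sum infsum h S_plus) S_plus"
    using h_sum[OF order_refl] by (simp add: summable_iff_has_sum_infsum)
  hence "(sum h \<longlongrightarrow> infsum h S_plus) (finite_subsets_at_top S_plus)"
    by (simp add: has_sum_def)
  moreover have "infsum h S_plus - c * (\<epsilon> / 2) < infsum h S_plus"
    using \<open>c > 0\<close> assms by simp
  ultimately have "\<forall>\<^sub>F X in finite_subsets_at_top S_plus. infsum h S_plus - c * (\<epsilon> / 2) < sum h X"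
    by (rule order_tendstoD)
  then obtain X where X: "finite X" "X \<subseteq> S_plus" "infsum h S_plus - c * (\<epsilon> / 2) < sum h X"
    unfolding eventually_finite_subsets_at_top by blast
  define M where "M = Max (insert 5 X)"
  have M5: "M \<ge> 5" and XM: "X \<subseteq> {-1..M}"
    using X by (auto simp: M_def S_plus_def intro: Max_ge)
  define I where "I = {-1..M}"
  have I: "finite I" "S_four \<subseteq> I" "I \<subseteq> S_plus"
    using M5 by (auto simp: I_def S_four_def S_plus_def)
  have tail: "infsum h (S_plus - I) \<le> c * (\<epsilon> / 2)"
  proof -
    have "sum h X \<le> sum h I"
      using XM I by (intro sum_mono2) (auto simp: h_nonneg I_def)
    moreover have "infsum h (S_plus - I) = infsum h S_plus - infsum h I"
      by (intro infsum_Diff h_sum) (use I in auto)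
    ultimately show ?thesis using X(3) I(1) by simp
  qed
  have "calF S_plus T - \<epsilon> \<le> calF I T" if T: "T \<in> {5/2..9/2}" for T
  proof -
    obtain l where l: "\<bar>l\<bar> \<le> R" "ln (partition_fun I l) - l * T < calF I T + min 1 (\<epsilon> / 2)"
      using near_minimiser_exists[OF I(2,3) T, of "min 1 (\<epsilon> / 2)"] assms by (auto simp: R_def)
    have Ipos: "partition_fun I l > 0" by (rule partition_fun_pos[OF I(2,3)])
    have "partition_fun S_plus l - partition_fun I l = infsum (f l) (S_plus - I)"
      unfolding partition_fun_def f_def
      by (rule infsum_Diff[OF gauss_summable[OF order_refl] gauss_summable[OF I(3)] I(3), symmetric])
    also have "\<dots> \<le> infsum h (S_plus - I)"
      by (intro infsum_mono f_sum h_sum fh l) auto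
    also note tail
    finally have 1: "partition_fun S_plus l \<le> partition_fun I l + c * (\<epsilon> / 2)" by simp
    have "c \<le> exp (l * of_int 2 - ln 2 / 2 * (of_int 2)\<^sup>2)"
      using l(1) by (simp add: c_def)
    also have "\<dots> \<le> partition_fun I l"
      by (rule partition_fun_ge_term) (use I in \<open>auto simp: S_four_def\<close>)
    finally have "c * (\<epsilon> / 2) \<le> partition_fun I l * (\<epsilon> / 2)"
      using assms by (intro mult_right_mono) auto
    with 1 have "partition_fun S_plus l \<le> partition_fun I l * (1 + \<epsilon> / 2)"
      by (simp add: algebra_simps)
    hence "ln (partition_fun S_plus l) \<le> ln (partition_fun I l * (1 + \<epsilon> / 2))"
      using partition_fun_pos[OF S_four_subset_S_plus order_refl, of l]
      by (subst ln_le_cancel_iff) (use Ipos assms in auto)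
    also have "\<dots> = ln (partition_fun I l) + ln (1 + \<epsilon> / 2)"
      using Ipos assms by (simp add: ln_mult)
    also have "ln (1 + \<epsilon> / 2) \<le> \<epsilon> / 2"
      using assms by (intro ln_add_one_self_le_self) auto
    finally have "ln (partition_fun S_plus l) - l * T \<le> calF I T + \<epsilon>" using l(2) by linarith
    moreover have "calF S_plus T \<le> ln (partition_fun S_plus l) - l * T"
      by (rule calF_le[OF S_four_subset_S_plus order_refl T])
    ultimately show ?thesis by linarith
  qed
  with M5 show ?thesis using that by (simp add: I_def)
qed

lemma gibbs_inequality:
  fixes a p :: "'a \<Rightarrow> real"
  assumes "finite I" "\<And>i. i \<in> I \<Longrightarrow> 0 \<le> p i" "sum p I = 1"
  shows "(\<Sum>i\<in>I. p i * (a i - ln (p i))) \<le> ln (\<Sum>i\<in>I. exp (a i))"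
proof -
  define Z where "Z = (\<Sum>i\<in>I. exp (a i))"
  have "I \<noteq> {}" using assms(3) by auto
  hence Z: "Z > 0" unfolding Z_def using assms(1) by (intro sum_pos) auto
  have "p i * (a i - ln (p i)) \<le> p i * ln Z + (exp (a i) / Z - p i)" if "i \<in> I" for i
  proof (cases "p i = 0")
    case False
    with assms(2)[OF that] have p: "p i > 0" by simp
    have "ln (exp (a i) / (Z * p i)) \<le> exp (a i) / (Z * p i) - 1"
      using Z p by (intro ln_le_minus_one) auto
    hence "a i - ln Z - ln (p i) \<le> exp (a i) / (Z * p i) - 1"
      using Z p by (simp add: ln_div ln_mult)
    hence "p i * (a i - ln Z - ln (p i)) \<le> p i * (exp (a i) / (Z * p i) - 1)"
      using p by (intro mult_left_mono) auto
    thus ?thesis using p by (simp add: algebra_simps)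
  qed (use Z in auto)
  hence "(\<Sum>i\<in>I. p i * (a i - ln (p i))) \<le> (\<Sum>i\<in>I. p i * ln Z + (exp (a i) / Z - p i))"
    by (rule sum_mono)
  also have "\<dots> = sum p I * ln Z + ((\<Sum>i\<in>I. exp (a i)) / Z - sum p I)"
    by (simp add: sum.distrib sum_subtractf sum_distrib_right sum_divide_distrib)
  also have "\<dots> = ln Z" using Z assms(3) by (simp flip: Z_def)
  finally show ?thesis by (simp add: Z_def)
qed

lemma calF_weak_duality:
  assumes "finite I" "I \<subseteq> S" "S_four \<subseteq> S" "S \<subseteq> S_plus"
    and "\<And>i. i \<in> I \<Longrightarrow> 0 \<le> p i" "sum p I = 1" "(\<Sum>i\<in>I. of_int i * p i) = T"
  shows "(\<Sum>i\<in>I. p i * (- (ln 2 / 2 * (of_int i)\<^sup>2) - ln (p i))) \<le> calF S T"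
  unfolding calF_eq
proof (rule cINF_greatest)
  fix l
  have "(\<Sum>i\<in>I. p i * (- (ln 2 / 2 * (of_int i)\<^sup>2) - ln (p i))) + l * T
      = (\<Sum>i\<in>I. p i * ((l * of_int i - ln 2 / 2 * (of_int i)\<^sup>2) - ln (p i)))"
    unfolding assms(7)[symmetric] sum_distrib_left sum.distrib[symmetric]
    by (rule sum.cong) (auto simp: algebra_simps)
  also have "\<dots> \<le> ln (partition_fun I l)"
    unfolding partition_fun_finite[OF assms(1)]
    by (rule gibbs_inequality) (use assms in auto)
  also have "\<dots> \<le> ln (partition_fun S l)"
  proof -
    have "I \<noteq> {}" using assms(6) by auto
    hence "partition_fun I l > 0"
      unfolding partition_fun_finite[OF assms(1)] using assms(1) by (intro sum_pos) auto
    thus ?thesis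
      using partition_fun_mono[OF assms(2,4), of l] by simp
  qed
  finally show "(\<Sum>i\<in>I. p i * (- (ln 2 / 2 * (of_int i)\<^sup>2) - ln (p i)))
      \<le> ln (partition_fun S l) - l * T" by linarith
qed simp

text \<open>The optimal measure is the Gibbs measure at the minimiser of the dual problem;
  stationarity of the dual function there says that its mean is \<open>T\<close>.\<close>

lemma calF_strong_duality:
  assumes "finite I" "S_four \<subseteq> I" "I \<subseteq> S_plus" "T \<in> {5/2..9/2}"
  obtains p where "\<And>i. 0 \<le> p i" "sum p I = 1" "(\<Sum>i\<in>I. of_int i * p i) = T"
    "calF I T \<le> (\<Sum>i\<in>I. p i * (- (ln 2 / 2 * (of_int i)\<^sup>2) - ln (p i)))"
proof -
  define R where "R = dual_radius + 1"
  define a where "a = (\<lambda>l i. l * of_int i - ln 2 / 2 * (of_int i)\<^sup>2 :: real)"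
  define Z where "Z = (\<lambda>l. \<Sum>i\<in>I. exp (a l i))"
  define g where "g = (\<lambda>l. ln (Z l) - l * T)"
  have Z_eq: "Z l = partition_fun I l" for l
    by (simp add: Z_def a_def partition_fun_finite[OF assms(1)])
  have Zpos: "Z l > 0" for l
    unfolding Z_eq by (rule partition_fun_pos[OF assms(2,3)])
  have deriv: "(g has_real_derivative ((\<Sum>i\<in>I. of_int i * exp (a l i)) / Z l - T)) (at l)" for l
  proof -
    have "(Z has_real_derivative (\<Sum>i\<in>I. of_int i * exp (a l i))) (at l)"
      unfolding Z_def a_def by (auto intro!: derivative_eq_intros sum.cong)
    thus ?thesis unfolding g_def using Zpos[of l]
      by (auto intro!: derivative_eq_intros)
  qed
  have "continuous_on {-R..R} g"
    using deriv by (meson DERIV_isCont continuous_at_imp_continuous_on)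
  moreover have "R \<ge> 3" using dual_radius_ge by (simp add: R_def)
  ultimately obtain l where l: "l \<in> {-R..R}" "\<And>l'. l' \<in> {-R..R} \<Longrightarrow> g l \<le> g l'"
    using continuous_attains_inf[of "{-R..R}" g] by auto
  have far: "g 0 + 1 < g l'" if "\<bar>l'\<bar> > dual_radius" for l'
    using near_minimiser_bounded[OF assms(2-4), of l'] that
    by (force simp: g_def Z_eq)
  have glob: "g l \<le> g l'" for l'
  proof (cases "\<bar>l'\<bar> \<le> R")
    case False
    hence "g 0 + 1 < g l'" by (intro far) (simp add: R_def)
    moreover have "g l \<le> g 0" using l \<open>R \<ge> 3\<close> by auto
    ultimately show ?thesis by simp
  next
    case True
    thus ?thesis by (intro l(2)) auto
  qed
  have stat: "(\<Sum>i\<in>I. of_int i * exp (a l i)) / Z l - T = 0"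
    by (rule DERIV_local_min[OF deriv, of 1 l]) (use glob in auto)
  define p where "p = (\<lambda>i. exp (a l i) / Z l)"
  have lnp: "ln (p i) = a l i - ln (Z l)" for i
    using Zpos[of l] by (simp add: p_def ln_div)
  have sum_p: "sum p I = 1"
    using Zpos[of l] by (simp add: p_def Z_def flip: sum_divide_distrib)
  have mean: "(\<Sum>i\<in>I. of_int i * p i) = T"
    using stat by (simp add: p_def flip: sum_divide_distrib)
  have "(\<Sum>i\<in>I. p i * (- (ln 2 / 2 * (of_int i)\<^sup>2) - ln (p i)))
      = (\<Sum>i\<in>I. p i * ln (Z l) - l * (of_int i * p i))"
    by (rule sum.cong) (auto simp: lnp a_def algebra_simps)
  also have "\<dots> = g l"
    using sum_p mean by (simp add: g_def sum_subtractf flip: sum_distrib_left sum_distrib_right)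
  also have "g l \<ge> calF I T"
    unfolding g_def Z_eq by (rule calF_le[OF assms(2-4)])
  finally have "calF I T \<le> (\<Sum>i\<in>I. p i * (- (ln 2 / 2 * (of_int i)\<^sup>2) - ln (p i)))" .
  moreover have "0 \<le> p i" for i using Zpos[of l] by (simp add: p_def)
  ultimately show ?thesis using that[of p] sum_p mean by auto
qed


section \<open>Reduction of the finite problem to the limiting one\<close>

text \<open>The part of \<open>ln (d_size (a - i))\<close> that is linear in \<open>i\<close> has slope \<open>- size_slope a\<close>, and
  \<open>size_error a i\<close> is what remains after removing also the quadratic part.\<close>

definition size_slope :: "int \<Rightarrow> real" where
  "size_slope a = (of_int a - 1 / 2) * ln 2 + ln (of_int a)"

definition size_error :: "int \<Rightarrow> int \<Rightarrow> real" where
  "size_error a i = ln (d_size (nat (a - i))) - ln (d_size (nat a))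
     + of_int i * size_slope a - ln 2 / 2 * (of_int i)\<^sup>2"

lemma d_size_pos: "d_size u > 0"
  by (simp add: d_size_def)

lemma ln_d_size_Suc: "ln (d_size (Suc u)) = ln (d_size u) + real u * ln 2 + ln (real (Suc u))"
proof -
  have "Suc u choose 2 = (u choose 2) + u"
    by (simp add: numeral_2_eq_2)
  hence "d_size (Suc u) = d_size u * 2 ^ u * real (Suc u)"
    by (simp add: d_size_def power_add)
  moreover have "ln (2 ^ u :: real) = real u * ln 2" by (simp add: ln_realpow)
  ultimately show ?thesis
    using d_size_pos[of u] by (simp add: ln_mult del: of_nat_Suc)
qed

lemma size_error_step:
  assumes "i < a"
  shows "size_error a (i + 1) = size_error a i + (ln (of_int a) - ln (of_int (a - i)))"
proof -
  define u where "u = nat (a - (i + 1))"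
  have u: "nat (a - i) = Suc u" "real u = of_int a - of_int i - 1"
    "real (Suc u) = of_int (a - i)"
    using assms by (auto simp: u_def)
  have "ln (d_size (nat (a - i))) = ln (d_size u) + (of_int a - of_int i - 1) * ln 2
      + ln (of_int (a - i))"
    unfolding u(1) ln_d_size_Suc u(2,3) by simp
  thus ?thesis
    unfolding size_error_def u_def[symmetric] size_slope_def
    by (simp add: field_simps power2_eq_square)
qed

lemma size_error_0 [simp]: "size_error a 0 = 0"
  by (simp add: size_error_def)

lemma size_error_minus_1:
  assumes "0 < a"
  shows "size_error a (-1) = ln (of_int (a + 1)) - ln (of_int a)"
  using size_error_step[of "-1" a] assms by simp

lemma size_error_nonneg:
  assumes "-1 \<le> i" "i < a"
  shows "0 \<le> size_error a i"
proof (cases "i = -1")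
  case True
  show ?thesis
  proof (cases "a = 0")
    case True
    with \<open>i = -1\<close> show ?thesis
      by (simp add: size_error_def size_slope_def d_size_def numeral_2_eq_2)
  next
    case False
    with True assms show ?thesis by (simp add: size_error_minus_1)
  qed
next
  case False
  with assms(1) have "0 \<le> i" by simp
  thus ?thesis using assms(2)
  proof (induction rule: int_ge_induct)
    case (step i)
    have "ln (real_of_int (a - i)) \<le> ln (of_int a)"
      using step.hyps step.prems by (intro ln_mono) auto
    with step show ?case by (simp add: size_error_step del: of_int_diff)
  qed simp
qed

lemma size_error_tendsto_0:
  assumes "-1 \<le> i" and "filterlim (\<lambda>n. real_of_int (a n)) at_top F"
  shows "((\<lambda>n. size_error (a n) i) \<longlongrightarrow> 0) F"
proof -
  have ln_shift: "((\<lambda>n. ln (real_of_int (a n) + y) - ln (real_of_int (a n))) \<longlongrightarrow> 0) F" for y :: real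
  proof -
    have "((\<lambda>x::real. ln (x + y) - ln x) \<longlongrightarrow> 0) at_top" by real_asymp
    thus ?thesis using assms(2) by (rule filterlim_compose)
  qed
  have ev: "eventually (\<lambda>n. a n > j) F" for j
  proof -
    have "eventually (\<lambda>n. real_of_int (a n) > of_int j) F"
      using assms(2) unfolding filterlim_at_top_dense by blast
    thus ?thesis by simp
  qed
  show ?thesis
  proof (cases "i = -1")
    case True
    have "eventually (\<lambda>n. ln (real_of_int (a n) + 1) - ln (real_of_int (a n)) = size_error (a n) i) F"
      using ev[of 0] by eventually_elim (simp add: True size_error_minus_1)
    with ln_shift[of 1] show ?thesis by (rule Lim_transform_eventually)
  next
    case False
    with assms(1) have "0 \<le> i" by simp
    thus ?thesis
    proof (induction rule: int_ge_induct)
      case (step i)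
      have "((\<lambda>n. size_error (a n) i - (ln (real_of_int (a n) + - of_int i) - ln (real_of_int (a n))))
          \<longlongrightarrow> 0 - 0) F"
        by (intro tendsto_diff step.IH ln_shift)
      hence "((\<lambda>n. size_error (a n) i - (ln (real_of_int (a n) + - of_int i) - ln (real_of_int (a n))))
          \<longlongrightarrow> 0) F" by simp
      moreover have "eventually (\<lambda>n. size_error (a n) i -
          (ln (real_of_int (a n) + - of_int i) - ln (real_of_int (a n))) = size_error (a n) (i + 1)) F"
        using ev[of i] by eventually_elim (simp add: size_error_step)
      ultimately show ?case by (rule Lim_transform_eventually)
    qed simp
  qed
qed

definition base_exponent :: "nat \<Rightarrow> real \<Rightarrow> real" where
  "base_exponent n s = s * ln (real n) - s + 1 - ln (real n) + ln s
     - ln (d_size (nat (alpha n))) + size_slope (alpha n) * (of_int (alpha n) - s)"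

lemma allocation_profile:
  assumes "\<kappa> \<in> allocations I n k" "k > 0"
  shows "(\<Sum>i\<in>I. \<kappa> i / k) = 1"
    and "(\<Sum>i\<in>I. of_int i * (\<kappa> i / k)) = of_int (alpha n) - real n / k"
    and "i \<in> I \<Longrightarrow> 0 \<le> \<kappa> i / k"
proof -
  have sum: "sum \<kappa> I = k" and size: "(\<Sum>i\<in>I. of_int (alpha n - i) * \<kappa> i) = real n"
    using assms(1) by (auto simp: allocations_def)
  show "(\<Sum>i\<in>I. \<kappa> i / k) = 1"
    using sum assms(2) by (simp flip: sum_divide_distrib)
  have "of_int (alpha n) * sum \<kappa> I - (\<Sum>i\<in>I. of_int i * \<kappa> i) = real n"
    using size by (simp add: sum_distrib_left left_diff_distrib sum_subtractf)
  hence "(\<Sum>i\<in>I. of_int i * \<kappa> i) = of_int (alpha n) * k - real n"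
    using sum by simp
  thus "(\<Sum>i\<in>I. of_int i * (\<kappa> i / k)) = of_int (alpha n) - real n / k"
    using assms(2) by (simp add: diff_divide_distrib flip: sum_divide_distrib)
  show "i \<in> I \<Longrightarrow> 0 \<le> \<kappa> i / k"
    using assms by (auto simp: allocations_def)
qed

lemma objective_eq:
  assumes "\<kappa> \<in> allocations I n k" "k > 0" "n > 0"
  shows "objective I n k \<kappa> = k * (base_exponent n (real n / k)
      + (\<Sum>i\<in>I. \<kappa> i / k * (- (ln 2 / 2 * (of_int i)\<^sup>2) - ln (\<kappa> i / k)))
      - (\<Sum>i\<in>I. \<kappa> i / k * size_error (alpha n) i))"
proof -
  define p where "p = (\<lambda>i. \<kappa> i / k)"
  define s where "s = real n / k"
  define D where "D = ln k + ln (d_size (nat (alpha n)))"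
  have p: "sum p I = 1" "(\<Sum>i\<in>I. of_int i * p i) = of_int (alpha n) - s"
    "\<And>i. i \<in> I \<Longrightarrow> 0 \<le> p i"
    using allocation_profile[OF assms(1,2)] by (auto simp: p_def s_def)
  have term_eq: "\<kappa> i * ln (\<kappa> i * d_size (nat (alpha n - i))) =
      k * (D * p i - size_slope (alpha n) * (of_int i * p i)
           - p i * (- (ln 2 / 2 * (of_int i)\<^sup>2) - ln (p i)) + p i * size_error (alpha n) i)"
    if "i \<in> I" for i
  proof (cases "p i = 0")
    case True
    thus ?thesis using assms(2) by (simp add: p_def)
  next
    case False
    hence pos: "p i > 0" using p(3)[OF that] by simp
    have \<kappa>: "\<kappa> i = k * p i" using assms(2) by (simp add: p_def)
    have "ln (\<kappa> i * d_size (nat (alpha n - i))) = ln k + ln (p i) + ln (d_size (nat (alpha n - i)))"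
      unfolding \<kappa> using pos assms(2) d_size_pos[of "nat (alpha n - i)"] by (simp add: ln_mult)
    also have "\<dots> = D + ln (p i) + size_error (alpha n) i - of_int i * size_slope (alpha n)
        + ln 2 / 2 * (of_int i)\<^sup>2"
      by (simp add: D_def size_error_def)
    finally have ln_eq: "ln (\<kappa> i * d_size (nat (alpha n - i))) = \<dots>" .
    show ?thesis unfolding ln_eq unfolding \<kappa> by (simp add: algebra_simps)
  qed
  have "(\<Sum>i\<in>I. \<kappa> i * ln (\<kappa> i * d_size (nat (alpha n - i)))) =
      k * (D * sum p I - size_slope (alpha n) * (\<Sum>i\<in>I. of_int i * p i)
        - (\<Sum>i\<in>I. p i * (- (ln 2 / 2 * (of_int i)\<^sup>2) - ln (p i)))
        + (\<Sum>i\<in>I. p i * size_error (alpha n) i))"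
    unfolding sum_distrib_left sum_subtractf[symmetric] sum.distrib[symmetric]
    by (rule sum.cong) (auto simp: term_eq)
  moreover have "real n = k * s" using assms(2) by (simp add: s_def)
  moreover have "ln k = ln (real n) - ln s"
    using assms(2,3) by (simp add: s_def ln_div)
  ultimately show ?thesis
    unfolding objective_def base_exponent_def s_def[symmetric] p(1,2) D_def
    by (simp add: p_def algebra_simps)
qed

lemma L_max_upper:
  assumes "finite I" "I \<subseteq> S" "S_four \<subseteq> S" "S \<subseteq> S_plus" "I \<subseteq> {-1..alpha n - 1}"
    and "feasible I n k" "n > 0"
  shows "L_max I n k \<le> k * (base_exponent n (real n / k) + calF S (of_int (alpha n) - real n / k))"
proof -
  have k: "k > 0" using assms(6) by (simp add: feasible_def)
  obtain \<kappa> where \<kappa>: "\<kappa> \<in> allocations I n k" "objective I n k \<kappa> = L_max I n k"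
    using L_is_maximum[OF assms(1,6)] by blast
  note profile = allocation_profile[OF \<kappa>(1) k]
  have "(\<Sum>i\<in>I. \<kappa> i / k * (- (ln 2 / 2 * (of_int i)\<^sup>2) - ln (\<kappa> i / k)))
      \<le> calF S (of_int (alpha n) - real n / k)"
    by (rule calF_weak_duality[OF assms(1-4)]) (use profile in auto)
  moreover have "0 \<le> (\<Sum>i\<in>I. \<kappa> i / k * size_error (alpha n) i)"
    using assms(5) profile(3) by (intro sum_nonneg mult_nonneg_nonneg size_error_nonneg) auto
  ultimately show ?thesis
    unfolding \<kappa>(2)[symmetric] objective_eq[OF \<kappa>(1) k assms(7)]
    using k by (intro mult_left_mono) auto
qed

lemma L_max_lower:
  assumes "finite I" "J \<subseteq> I" "S_four \<subseteq> J" "J \<subseteq> S_plus" "k > 0" "n > 0"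
    and "of_int (alpha n) - real n / k \<in> {5/2..9/2}"
    and "\<And>i. i \<in> J \<Longrightarrow> size_error (alpha n) i \<le> \<epsilon>"
  shows "k * (base_exponent n (real n / k) + calF J (of_int (alpha n) - real n / k) - \<epsilon>)
    \<le> L_max I n k"
proof -
  have finJ: "finite J" using assms(1,2) finite_subset by blast
  obtain p where p: "\<And>i. 0 \<le> p i" "sum p J = 1"
      "(\<Sum>i\<in>J. of_int i * p i) = of_int (alpha n) - real n / k"
      "calF J (of_int (alpha n) - real n / k)
        \<le> (\<Sum>i\<in>J. p i * (- (ln 2 / 2 * (of_int i)\<^sup>2) - ln (p i)))"
    using calF_strong_duality[OF finJ assms(3,4,7)] by blast
  define q where "q = (\<lambda>i. if i \<in> J then p i else 0)"
  define \<kappa> where "\<kappa> = (\<lambda>i. k * q i)"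
  have restrict: "(\<Sum>i\<in>I. q i * f i) = (\<Sum>i\<in>J. p i * f i)" for f
    using assms(1,2) by (intro sum.mono_neutral_cong_right) (auto simp: q_def)
  have "sum q I = 1" using restrict[of "\<lambda>_. 1"] p(2) by simp
  have "(\<Sum>i\<in>I. of_int (alpha n - i) * \<kappa> i) =
      k * of_int (alpha n) * (\<Sum>i\<in>I. q i) - k * (\<Sum>i\<in>I. q i * of_int i)"
    unfolding sum_distrib_left sum_subtractf[symmetric]
    by (rule sum.cong) (auto simp: \<kappa>_def algebra_simps)
  also have "\<dots> = real n"
    using p(3) \<open>sum q I = 1\<close> assms(5) unfolding restrict[of of_int]
    by (simp add: mult.commute[of "p _"] right_diff_distrib)
  finally have \<kappa>: "\<kappa> \<in> allocations I n k"
    using p(1) assms(5) \<open>sum q I = 1\<close>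
    by (auto simp: allocations_def \<kappa>_def q_def simp flip: sum_distrib_left)
  hence "feasible I n k" using assms(5) by (auto simp: feasible_def)
  from L_is_maximum[OF assms(1) this] \<kappa> have "objective I n k \<kappa> \<le> L_max I n k"
    by force
  moreover have "\<kappa> i / k = q i" for i using assms(5) by (simp add: \<kappa>_def)
  moreover have "(\<Sum>i\<in>I. q i * (- (ln 2 / 2 * (of_int i)\<^sup>2) - ln (q i)))
      = (\<Sum>i\<in>J. p i * (- (ln 2 / 2 * (of_int i)\<^sup>2) - ln (p i)))"
    unfolding restrict by (rule sum.cong) (auto simp: q_def)
  moreover have "(\<Sum>i\<in>I. q i * size_error (alpha n) i) \<le> \<epsilon>"
  proof -
    have "(\<Sum>i\<in>J. p i * size_error (alpha n) i) \<le> (\<Sum>i\<in>J. p i * \<epsilon>)"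
      using p(1) assms(8) by (intro sum_mono mult_left_mono) auto
    also have "\<dots> = \<epsilon>" using p(2) by (simp flip: sum_distrib_right)
    finally show ?thesis unfolding restrict .
  qed
  ultimately show ?thesis
    using objective_eq[OF \<kappa> assms(5,6)] p(4) assms(5)
    by (auto elim!: order_trans[rotated] intro!: mult_left_mono)
qed


section \<open>Asymptotics\<close>

lemma alpha0_over_ln: "(\<lambda>n. alpha0 n / ln (real n)) \<longlonglongrightarrow> 2 / ln 2"
proof -
  have "(\<lambda>n. alpha0 n / ln (real n)) \<longlonglongrightarrow> 2 * inverse (ln 2)"
    unfolding alpha0_def log_def by real_asymp
  thus ?thesis by (simp add: divide_inverse)
qed

lemma inverse_ln_tendsto_0: "(\<lambda>n. 1 / ln (real n)) \<longlonglongrightarrow> 0"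
  by real_asymp

lemma eventually_ln_gt: "\<forall>\<^sub>F n in sequentially. ln (real n) > C"
proof -
  have "filterlim (\<lambda>n. ln (real n)) at_top sequentially" by real_asymp
  thus ?thesis unfolding filterlim_at_top_dense by blast
qed

lemma bounded_over_ln_tendsto_0:
  assumes "\<forall>\<^sub>F n in sequentially. \<bar>f n\<bar> \<le> (C :: real)"
  shows "(\<lambda>n. f n / ln (real n)) \<longlonglongrightarrow> 0"
  using lim_null_mult_left_bounded[OF _ inverse_ln_tendsto_0, of f C] assms by simp

lemma delta_bounds: "delta n \<in> {0..1}"
  unfolding delta_def alpha_def by (simp; linarith)

lemma T_of_bounds:
  assumes "\<delta> \<in> {0..1}"
  shows "T_of \<delta> \<in> {11/4..17/4}"
proof -
  have "2 / ln 2 \<ge> (72/25 :: real)" "2 / ln 2 \<le> (3 :: real)"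
    using ln2_ge_two_thirds ln2_le_25_over_36 by (simp_all add: field_simps)
  thus ?thesis using assms unfolding T_of_def by auto
qed

lemma alpha_over_ln: "(\<lambda>n. of_int (alpha n) / ln (real n)) \<longlonglongrightarrow> 2 / ln 2"
proof -
  have "(\<lambda>n. delta n / ln (real n)) \<longlonglongrightarrow> 0"
    by (rule bounded_over_ln_tendsto_0[of _ 1]) (use delta_bounds in auto)
  from tendsto_diff[OF alpha0_over_ln this] show ?thesis
    by (simp add: delta_def diff_divide_distrib)
qed

lemma alpha_at_top: "filterlim (\<lambda>n. real_of_int (alpha n)) at_top sequentially"
proof -
  have "filterlim alpha0 at_top sequentially"
    unfolding alpha0_def log_def by real_asymp
  hence "filterlim (\<lambda>n. - 1 + alpha0 n) at_top sequentially"
    by (rule filterlim_tendsto_add_at_top[OF tendsto_const])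
  thus ?thesis
    by (rule filterlim_at_top_mono)
       (use delta_bounds in \<open>auto simp: delta_def algebra_simps intro!: always_eventually\<close>)
qed

lemma size_slope_over_ln: "(\<lambda>n. size_slope (alpha n) / ln (real n)) \<longlonglongrightarrow> 2"
proof -
  define a where "a = (\<lambda>n. real_of_int (alpha n))"
  define L where "L = (\<lambda>n. ln (real n))"
  have "(\<lambda>n. ln (a n) / a n) \<longlonglongrightarrow> 0"
    unfolding a_def by (rule filterlim_compose[OF ln_x_over_x_tendsto_0 alpha_at_top])
  hence "(\<lambda>n. (a n / L n - 1 / 2 * (1 / L n)) * ln 2 + ln (a n) / a n * (a n / L n))
      \<longlonglongrightarrow> (2 / ln 2 - 1 / 2 * 0) * ln 2 + 0 * (2 / ln 2)"
    unfolding a_def L_def by (intro tendsto_intros alpha_over_ln inverse_ln_tendsto_0)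
  hence "(\<lambda>n. (a n / L n - 1 / 2 * (1 / L n)) * ln 2 + ln (a n) / a n * (a n / L n)) \<longlonglongrightarrow> 2"
    by simp
  moreover have "\<forall>\<^sub>F n in sequentially. a n > 0"
    using alpha_at_top unfolding filterlim_at_top_dense a_def by blast
  hence "\<forall>\<^sub>F n in sequentially. (a n / L n - 1 / 2 * (1 / L n)) * ln 2
      + ln (a n) / a n * (a n / L n) = size_slope (alpha n) / L n"
    by eventually_elim
       (simp add: size_slope_def a_def diff_divide_distrib add_divide_distrib left_diff_distrib)
  ultimately show ?thesis
    unfolding L_def by (rule Lim_transform_eventually)
qed

lemma window_tendsto_0: "(\<lambda>n. A * ln (ln (real n)) / ln (real n)) \<longlonglongrightarrow> 0"
  by real_asymp

lemma s0_over_ln: "(\<lambda>n. s0 n / ln (real n)) \<longlonglongrightarrow> 2 / ln 2"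
proof -
  define C :: real where "C = 1 + 2 / ln 2"
  have "(\<lambda>n. C / ln (real n)) \<longlonglongrightarrow> 0"
    by (rule bounded_over_ln_tendsto_0[of _ "\<bar>C\<bar>"]) simp
  moreover have "s0 n = alpha0 n - C" for n by (simp add: s0_def C_def)
  ultimately show ?thesis
    using tendsto_diff[OF alpha0_over_ln, of "\<lambda>n. C / ln (real n)" 0]
    by (simp add: diff_divide_distrib)
qed

lemma ratio_over_ln:
  assumes "\<forall>\<^sub>F n in sequentially. is_root A (I n) c n (k n)"
  shows "(\<lambda>n. (real n / k n) / ln (real n)) \<longlonglongrightarrow> 2 / ln 2"
proof -
  have "\<forall>\<^sub>F n in sequentially. A * ln (ln (real n)) / ln (real n) < 1"
    using window_tendsto_0 by (rule order_tendstoD) simp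
  with assms have "\<forall>\<^sub>F n in sequentially. \<bar>real n / k n - s0 n\<bar> \<le> 1"
    by eventually_elim (auto simp: is_root_def)
  hence "(\<lambda>n. (real n / k n - s0 n) / ln (real n)) \<longlonglongrightarrow> 0"
    by (rule bounded_over_ln_tendsto_0)
  from tendsto_add[OF this s0_over_ln] show ?thesis
    by (simp add: diff_divide_distrib)
qed

text \<open>At a root, the mean offset \<open>\<alpha> - n / k\<close> is asymptotically \<open>T_of \<delta>\<close>, so the
  root equation determines the base exponent up to \<open>o(1)\<close>.\<close>

lemma base_exponent_at_root:
  assumes root: "\<forall>\<^sub>F n in sequentially. is_root A (I n) c n (k n)"
    and S: "S_four \<subseteq> S" "S \<subseteq> S_plus"
    and I: "\<And>n. finite (I n)" "\<And>n. I n \<subseteq> S"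
      "\<forall>\<^sub>F n in sequentially. I n \<subseteq> {-1..alpha n - 1}"
    and trunc: "\<And>\<epsilon>. \<epsilon> > 0 \<Longrightarrow> \<exists>J. finite J \<and> S_four \<subseteq> J \<and> J \<subseteq> S_plus \<and>
      (\<forall>\<^sub>F n in sequentially. J \<subseteq> I n) \<and> (\<forall>T\<in>{5/2..9/2}. calF S T - \<epsilon> \<le> calF J T)"
  shows "(\<lambda>n. base_exponent n (real n / k n) + calF S (T_of (delta n)) + c) \<longlonglongrightarrow> 0"
proof (rule tendstoI)
  fix e :: real assume "e > 0"
  define w where "w = (\<lambda>n. A * ln (ln (real n)) / ln (real n))"
  obtain J where J: "finite J" "S_four \<subseteq> J" "J \<subseteq> S_plus" "\<forall>\<^sub>F n in sequentially. J \<subseteq> I n"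
      "\<And>T. T \<in> {5/2..9/2} \<Longrightarrow> calF S T - e / 4 \<le> calF J T"
    using trunc[of "e / 4"] \<open>e > 0\<close> by auto
  have "\<forall>\<^sub>F n in sequentially. \<forall>i\<in>J. size_error (alpha n) i < e / 4"
  proof (intro eventually_ball_finite[OF J(1)] ballI)
    fix i assume "i \<in> J"
    hence "-1 \<le> i" using J(3) by (auto simp: S_plus_def)
    from size_error_tendsto_0[OF this alpha_at_top]
    show "\<forall>\<^sub>F n in sequentially. size_error (alpha n) i < e / 4"
      by (rule order_tendstoD) (use \<open>e > 0\<close> in simp)
  qed
  moreover have "\<forall>\<^sub>F n in sequentially. w n < min (1 / 4) (e / (4 * dual_radius))"
    unfolding w_def
    by (rule order_tendstoD[OF window_tendsto_0]) (use \<open>e > 0\<close> dual_radius_ge in auto)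
  ultimately show "\<forall>\<^sub>F n in sequentially.
      dist (base_exponent n (real n / k n) + calF S (T_of (delta n)) + c) 0 < e"
    using root I(3) J(4) eventually_gt_at_top[of 0]
  proof eventually_elim
    case (elim n)
    define B where "B = base_exponent n (real n / k n)"
    define T where "T = of_int (alpha n) - real n / k n"
    define T' where "T' = T_of (delta n)"
    have R: "feasible (I n) n (k n)" "L_max (I n) n (k n) = - c * k n"
        "\<bar>real n / k n - s0 n\<bar> \<le> w n"
      using elim(3) by (auto simp: is_root_def w_def)
    have k: "k n > 0" using R(1) by (simp add: feasible_def)
    have "T' - T = real n / k n - s0 n"
      by (simp add: T_def T'_def T_of_def delta_def s0_def)
    hence TT: "\<bar>T' - T\<bar> \<le> w n" using R(3) by simp
    have T': "T' \<in> {11/4..17/4}" unfolding T'_def by (intro T_of_bounds delta_bounds)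
    with TT elim(2) have T: "T \<in> {5/2..9/2}" and T'5: "T' \<in> {5/2..9/2}" by auto
    have "\<bar>calF S T' - calF S T\<bar> \<le> dual_radius * \<bar>T' - T\<bar>"
      by (rule calF_lipschitz[OF S T T'5])
    also have "\<dots> \<le> dual_radius * (e / (4 * dual_radius))"
      using TT elim(2) dual_radius_ge by (intro mult_left_mono) auto
    also have "\<dots> = e / 4" using dual_radius_ge by simp
    finally have lip: "\<bar>calF S T' - calF S T\<bar> \<le> e / 4" .
    have "- c * k n \<le> k n * (B + calF S T)"
      using L_max_upper[OF I(1) I(2) S elim(4) R(1) elim(6)] R(2) by (simp add: B_def T_def)
    hence "k n * (- c) \<le> k n * (B + calF S T)" by (simp add: mult.commute)
    hence low: "- c \<le> B + calF S T" using k by (simp only: mult_le_cancel_left_pos)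
    have "k n * (B + calF J T - e / 4) \<le> - c * k n"
      unfolding R(2)[symmetric] B_def T_def
      by (rule L_max_lower[OF I(1) elim(5) J(2,3) k elim(6)])
         (use T elim(1) in \<open>auto simp: T_def less_imp_le\<close>)
    hence "k n * (B + calF J T - e / 4) \<le> k n * (- c)" by (simp add: mult.commute)
    hence "B + calF J T - e / 4 \<le> - c" using k by (simp only: mult_le_cancel_left_pos)
    with low lip J(5)[OF T] \<open>e > 0\<close> show ?case
      unfolding B_def[symmetric] T'_def[symmetric] dist_real_def by linarith
  qed
qed

lemma base_exponent_diff:
  "base_exponent n s - base_exponent n t =
    (s - t) * (ln (real n) - 1 - size_slope (alpha n)) + (ln s - ln t)"
  by (simp add: base_exponent_def algebra_simps)

lemma A4_bounded:
  assumes "\<delta> \<in> {0..1}"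
  shows "\<bar>A4 \<delta>\<bar> \<le> ln 2 + 2 * dual_radius"
proof -
  have T: "T_of \<delta> \<in> {5/2..9/2}" using T_of_bounds[OF assms] by auto
  have "ln 2 > (0 :: real)" by simp
  with calF_bounded[OF S_four_subset_S_plus order_refl T]
    calF_bounded[OF order_refl S_four_subset_S_plus T]
  show ?thesis unfolding A4_def by linarith
qed

text \<open>Since the base exponent has slope \<open>- (1 + o(1)) ln n\<close>, a bounded gap in it corresponds
  to a gap of order \<open>1 / ln n\<close> between the ratios \<open>n / k\<close>, each of which is \<open>(2 / ln 2 + o(1)) ln n\<close>.\<close>

lemma root_gap:
  fixes k l a :: "nat \<Rightarrow> real"
  assumes k: "(\<lambda>n. (real n / k n) / ln (real n)) \<longlonglongrightarrow> 2 / ln 2"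
    and l: "(\<lambda>n. (real n / l n) / ln (real n)) \<longlonglongrightarrow> 2 / ln 2"
    and gap: "(\<lambda>n. base_exponent n (real n / k n) - base_exponent n (real n / l n) - a n) \<longlonglongrightarrow> 0"
    and a: "\<And>n. \<bar>a n\<bar> \<le> C"
  shows "\<exists>\<epsilon>. \<epsilon> \<longlonglongrightarrow> 0 \<and> (\<forall>\<^sub>F n in sequentially.
    k n - l n = ((ln 2)\<^sup>2 / 4 * a n + \<epsilon> n) * (real n / ln (real n) ^ 3))"
proof -
  define s where "s = (\<lambda>n. real n / k n)"
  define t where "t = (\<lambda>n. real n / l n)"
  define L where "L = (\<lambda>n. ln (real n))"
  define X where "X = (\<lambda>n. base_exponent n (s n) - base_exponent n (t n) - a n)"
  define \<theta> where "\<theta> = (\<lambda>n. (ln (s n) - ln (t n)) / (s n - t n))"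
  define Q where "Q = (\<lambda>n. size_slope (alpha n) / L n + 1 / L n - 1 - \<theta> n / L n)"
  define P where "P = (\<lambda>n. 1 / (Q n * (s n / L n) * (t n / L n)))"
  have pos: "2 / ln 2 > (1::real)"
    using ln2_le_25_over_36 by (simp add: field_simps)
  have sL: "\<forall>\<^sub>F n in sequentially. s n / L n > 1" and tL: "\<forall>\<^sub>F n in sequentially. t n / L n > 1"
    using order_tendstoD(1)[OF k pos] order_tendstoD(1)[OF l pos] by (simp_all add: s_def t_def L_def)
  have L1: "\<forall>\<^sub>F n in sequentially. L n > 1" unfolding L_def by (rule eventually_ln_gt)
  have \<theta>: "\<forall>\<^sub>F n in sequentially. \<bar>\<theta> n\<bar> \<le> 1"
    using sL tL L1
  proof eventually_elim
    case (elim n)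
    have lip: "ln x - ln y \<le> \<bar>x - y\<bar>" if "x \<ge> 1" "y \<ge> 1" for x y :: real
    proof -
      have "ln x - ln y \<le> (x - y) / y" using that by (intro ln_diff_le) auto
      also have "\<dots> \<le> \<bar>x - y\<bar> / y" using that by (intro divide_right_mono) auto
      also have "\<dots> \<le> \<bar>x - y\<bar> / 1" using that by (intro divide_left_mono) auto
      finally show ?thesis by simp
    qed
    have st: "s n \<ge> 1" "t n \<ge> 1"
      using elim by (auto simp: field_simps)
    have "\<bar>ln (s n) - ln (t n)\<bar> \<le> \<bar>s n - t n\<bar>"
      using lip[OF st] lip[OF st(2,1)] by linarith
    thus ?case by (simp add: \<theta>_def divide_le_eq_1)
  qed
  have "(\<lambda>n. \<theta> n / L n) \<longlonglongrightarrow> 0"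
    unfolding L_def by (rule bounded_over_ln_tendsto_0[OF \<theta>])
  hence "Q \<longlonglongrightarrow> 2 + 0 - 1 - 0"
    unfolding Q_def L_def
    by (intro tendsto_intros size_slope_over_ln inverse_ln_tendsto_0)
  hence Q: "Q \<longlonglongrightarrow> 1" by simp
  have "P \<longlonglongrightarrow> 1 / (1 * (2 / ln 2) * (2 / ln 2))"
    unfolding P_def s_def t_def L_def by (intro tendsto_intros Q k l) auto
  hence P: "P \<longlonglongrightarrow> (ln 2)\<^sup>2 / 4" by (simp add: power2_eq_square)
  have X: "X \<longlonglongrightarrow> 0" using gap by (simp add: X_def s_def t_def)
  define \<epsilon> where "\<epsilon> = (\<lambda>n. a n * (P n - (ln 2)\<^sup>2 / 4) + X n * P n)"
  have "(\<lambda>n. a n * (P n - (ln 2)\<^sup>2 / 4)) \<longlonglongrightarrow> 0"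
    by (rule lim_null_mult_left_bounded[of _ C]) (use a P in \<open>auto simp: LIM_zero\<close>)
  moreover have "(\<lambda>n. X n * P n) \<longlonglongrightarrow> 0"
    using tendsto_mult[OF X P] by simp
  ultimately have "\<epsilon> \<longlonglongrightarrow> 0"
    unfolding \<epsilon>_def using tendsto_add by fastforce
  moreover have "\<forall>\<^sub>F n in sequentially. Q n > 0"
    using order_tendstoD(1)[OF Q] by simp
  hence "\<forall>\<^sub>F n in sequentially.
      k n - l n = ((ln 2)\<^sup>2 / 4 * a n + \<epsilon> n) * (real n / ln (real n) ^ 3)"
    using sL tL L1 eventually_gt_at_top[of 0]
  proof eventually_elim
    case (elim n)
    have s: "s n > 0" and t: "t n > 0" and L: "L n > 0"
      using elim by (auto simp: field_simps intro: less_trans)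
    have kn: "k n = real n / s n" "l n = real n / t n"
      using elim(5) by (simp_all add: s_def t_def)
    have \<theta>_eq: "ln (s n) - ln (t n) = \<theta> n * (s n - t n)"
      by (simp add: \<theta>_def)
    have QL: "Q n * L n = size_slope (alpha n) + 1 - L n - \<theta> n"
      using L by (simp add: Q_def algebra_simps)
    have "a n + X n = base_exponent n (s n) - base_exponent n (t n)"
      by (simp add: X_def)
    also have "\<dots> = (t n - s n) * (Q n * L n)"
      unfolding base_exponent_diff \<theta>_eq QL by (simp add: L_def algebra_simps)
    finally have ts: "t n - s n = (a n + X n) / (Q n * L n)"
      using elim(1) L by simp
    have "k n - l n = real n * (t n - s n) / (s n * t n)"
      unfolding kn using s t by (simp add: field_simps)
    also have "\<dots> = (a n + X n) * P n * (real n / L n ^ 3)"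
      unfolding ts P_def using s t L elim(1) by (simp add: field_simps power3_eq_cube)
    also have "(a n + X n) * P n = (ln 2)\<^sup>2 / 4 * a n + \<epsilon> n"
      by (simp add: \<epsilon>_def algebra_simps)
    finally show ?case by (simp add: L_def)
  qed
  ultimately show ?thesis by blast
qed

theorem mainTheorem2:
  fixes A :: real
  assumes "admissible_window A"
  shows "\<exists>\<epsilon> :: nat \<Rightarrow> real. \<epsilon> \<longlonglongrightarrow> 0 \<and>
    (\<forall>\<^sub>F n in sequentially.
       r_plus A n - r_four_co A n =
         ((ln 2)\<^sup>2 / 4 * A4 (delta n) + \<epsilon> n) * (real n / (ln (real n)) ^ 3))"
proof -
  have ex1: "\<forall>\<^sub>F n in sequentially. \<forall>I\<in>{S_plus_upto n, S_four_upto n}. \<forall>c\<in>{0..ln 2}.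
       \<exists>!k. is_root A I c n k"
    using assms by (simp add: admissible_window_def)
  have root_plus: "\<forall>\<^sub>F n in sequentially. is_root A (S_plus_upto n) 0 n (r_plus A n)"
    using ex1 unfolding r_plus_def fm_root_def by eventually_elim (rule theI', simp)
  have root_four: "\<forall>\<^sub>F n in sequentially. is_root A (S_four_upto n) (ln 2) n (r_four_co A n)"
    using ex1 unfolding r_four_co_def fm_root_def by eventually_elim (rule theI', simp)
  have alpha_ge: "\<forall>\<^sub>F n in sequentially. m < alpha n" for m
  proof -
    have "\<forall>\<^sub>F n in sequentially. real_of_int (alpha n) > of_int m"
      using alpha_at_top unfolding filterlim_at_top_dense by blast
    thus ?thesis by simp
  qed
  have plus: "(\<lambda>n. base_exponent n (real n / r_plus A n) + calF S_plus (T_of (delta n)) + 0) \<longlonglongrightarrow> 0"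
  proof (rule base_exponent_at_root[OF root_plus S_four_subset_S_plus order_refl])
    fix \<epsilon> :: real assume "\<epsilon> > 0"
    then obtain M where M: "5 \<le> M"
        "\<And>T. T \<in> {5/2..9/2} \<Longrightarrow> calF S_plus T - \<epsilon> \<le> calF {-1..M} T"
      using calF_truncation by blast
    have "\<forall>\<^sub>F n in sequentially. {-1..M} \<subseteq> S_plus_upto n"
      using alpha_ge[of M] by eventually_elim (auto simp: S_plus_upto_def)
    with M show "\<exists>J. finite J \<and> S_four \<subseteq> J \<and> J \<subseteq> S_plus \<and>
        (\<forall>\<^sub>F n in sequentially. J \<subseteq> S_plus_upto n) \<and>
        (\<forall>T\<in>{5/2..9/2}. calF S_plus T - \<epsilon> \<le> calF J T)"
      by (intro exI[of _ "{-1..M}"]) (auto simp: S_four_def S_plus_def)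
  qed (auto simp: S_plus_upto_def S_plus_def)
  have four: "(\<lambda>n. base_exponent n (real n / r_four_co A n) + calF S_four (T_of (delta n)) + ln 2)
      \<longlonglongrightarrow> 0"
  proof (rule base_exponent_at_root[OF root_four order_refl S_four_subset_S_plus])
    show "\<forall>\<^sub>F n in sequentially. S_four_upto n \<subseteq> {-1..alpha n - 1}"
      using alpha_ge[of 5] by eventually_elim (auto simp: S_four_upto_def S_four_def)
    fix \<epsilon> :: real assume "\<epsilon> > 0"
    thus "\<exists>J. finite J \<and> S_four \<subseteq> J \<and> J \<subseteq> S_plus \<and>
        (\<forall>\<^sub>F n in sequentially. J \<subseteq> S_four_upto n) \<and>
        (\<forall>T\<in>{5/2..9/2}. calF S_four T - \<epsilon> \<le> calF J T)"
      using S_four_subset_S_plus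
      by (intro exI[of _ S_four]) (auto simp: S_four_upto_def, simp add: S_four_def)
  qed (auto simp: S_four_upto_def S_four_def)
  show ?thesis
  proof (rule root_gap[OF ratio_over_ln[OF root_plus] ratio_over_ln[OF root_four]])
    show "(\<lambda>n. base_exponent n (real n / r_plus A n) - base_exponent n (real n / r_four_co A n)
        - A4 (delta n)) \<longlonglongrightarrow> 0"
      using tendsto_diff[OF plus four] by (simp add: A4_def algebra_simps)
    show "\<bar>A4 (delta n)\<bar> \<le> ln 2 + 2 * dual_radius" for n
      by (rule A4_bounded[OF delta_bounds])
  qed
qed

end
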